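(* Let $\Gamma=(U_1,U_2^t)$ be a bimatrix game in which player 1 has $m_1$ actions and player 2 has $m_2$ actions, with $\max\{m_1,m_2\}\ge 2$. (1) If $\Gamma$ has a super strong Nash equilibrium with fully mixed strategies, then $\Gamma$ is a strictly competitive game. (2) If $\Gamma$ has a strong Nash equilibrium with fully mixed strategies, the payoffs being normalized so that both players get utility zero at this equilibrium, then either $\Gamma$ is a strictly competitive game, or all the entries of the bimatrix $(U_1,U_2^t)$ lie on the vertical line through the origin, or all of them lie on the horizontal line through the origin.
   Context: In the bimatrix game $(U_1,U_2^t)$, $U_1=(u_1^{ij})\in\mathbb{R}^{m_1\times m_2}$ and $U_2=(u_2^{ji})\in\mathbb{R}^{m_2\times m_1}$; the entries of the bimatrix are the points $u^{ij}=(u_1^{ij},u_2^{ji})\in\mathbb{R}^2$. A mixed strategy of player $i$ is a vector $x_i$ in the simplex $\Delta_i=\{x_i\in\mathbb{R}^{m_i}: x_i\ge 0,\ \sum_k x_{ik}=1\}$. At the profile $x=(x_1,x_2)$ player 1 gets $v_1(x)=x_1^tU_1x_2$ and player 2 gets $v_2(x)=x_2^tU_2x_1$. The profile is fully mixed if all components of $x_1$ and of $x_2$ are strictly positive. A Nash equilibrium is a profile at which no player can strictly increase her own utility by unilaterally changing her mixed strategy. For a coalition $C$ of players (a nonempty subset), a profile $\bar x$ is weakly Pareto efficient for $C$ if there is no profile $y$, with $y_i=\bar x_i$ for all $i\notin C$ and $y_i\in\Delta_i$ arbitrary for $i\in C$, such that $v_i(y)>v_i(\bar x)$ for all $i\in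 C$. It is strictly Pareto efficient for $C$ if there is no such $y$ with $v_i(y)\ge v_i(\bar x)$ for all $i\in C$ and strict inequality for at least one $i\in C$. A strong (respectively super strong) Nash equilibrium is a Nash equilibrium that is weakly (respectively strictly) Pareto efficient for every coalition. A bimatrix game is strictly competitive if, up to a suitable rescaling (a positive affine transformation) of the utility of one player, it is zero-sum. *)

theory Defs
  imports "HOL-Analysis.Analysis"
begin

text \<open>
  The numbers of actions are the cardinalities of the finite index types \<open>'m\<close>
  (player 1) and \<open>'n\<close> (player 2). A bimatrix game is given by
  \<open>U1 :: real^'n^'m\<close> and \<open>U2 :: real^'m^'n\<close>; each player's own actions index the
  rows of her matrix, so the payoffs of the cell \<open>(i, j)\<close> are \<open>U1 $ i $ j\<close> and
  \<open>U2 $ j $ i\<close>.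
\<close>

datatype player = Player1 | Player2

type_synonym ('m, 'n) profile = "(real^'m) \<times> (real^'n)"

definition simplex_strategies :: "(real^'k::finite) set" where
  "simplex_strategies = {x. (\<forall>k. 0 \<le> x $ k) \<and> (\<Sum>k\<in>UNIV. x $ k) = 1}"

definition profiles :: "('m::finite, 'n::finite) profile set" where
  "profiles = simplex_strategies \<times> simplex_strategies"

definition fully_mixed :: "('m::finite, 'n::finite) profile \<Rightarrow> bool" where
  "fully_mixed x \<longleftrightarrow> (\<forall>i. 0 < fst x $ i) \<and> (\<forall>j. 0 < snd x $ j)"

fun payoff ::
  "real^'n::finite^'m::finite \<Rightarrow> real^'m^'n \<Rightarrow> player \<Rightarrow> ('m, 'n) profile \<Rightarrow> real" where
  "payoff U1 U2 Player1 x = fst x \<bullet> (U1 *v snd x)"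
| "payoff U1 U2 Player2 x = snd x \<bullet> (U2 *v fst x)"

definition coalition_deviations ::
  "player set \<Rightarrow> ('m::finite, 'n::finite) profile \<Rightarrow> ('m, 'n) profile set" where
  "coalition_deviations C x =
    {y \<in> profiles. (Player1 \<notin> C \<longrightarrow> fst y = fst x) \<and> (Player2 \<notin> C \<longrightarrow> snd y = snd x)}"

definition nash_equilibrium ::
  "real^'n::finite^'m::finite \<Rightarrow> real^'m^'n \<Rightarrow> ('m, 'n) profile \<Rightarrow> bool" where
  "nash_equilibrium U1 U2 x \<longleftrightarrow> x \<in> profiles \<and>
    (\<forall>p. \<not> (\<exists>y \<in> coalition_deviations {p} x. payoff U1 U2 p y > payoff U1 U2 p x))"

definition weakly_pareto_efficient ::
  "real^'n::finite^'m::finite \<Rightarrow> real^'m^'n \<Rightarrow> player set \<Rightarrow> ('m, 'n) profile \<Rightarrow> bool" where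
  "weakly_pareto_efficient U1 U2 C x \<longleftrightarrow>
    \<not> (\<exists>y \<in> coalition_deviations C x. \<forall>p\<in>C. payoff U1 U2 p y > payoff U1 U2 p x)"

definition strictly_pareto_efficient ::
  "real^'n::finite^'m::finite \<Rightarrow> real^'m^'n \<Rightarrow> player set \<Rightarrow> ('m, 'n) profile \<Rightarrow> bool" where
  "strictly_pareto_efficient U1 U2 C x \<longleftrightarrow>
    \<not> (\<exists>y \<in> coalition_deviations C x.
          (\<forall>p\<in>C. payoff U1 U2 p y \<ge> payoff U1 U2 p x) \<and>
          (\<exists>p\<in>C. payoff U1 U2 p y > payoff U1 U2 p x))"

definition strong_nash ::
  "real^'n::finite^'m::finite \<Rightarrow> real^'m^'n \<Rightarrow> ('m, 'n) profile \<Rightarrow> bool" where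
  "strong_nash U1 U2 x \<longleftrightarrow> nash_equilibrium U1 U2 x \<and>
    (\<forall>C. C \<noteq> {} \<longrightarrow> weakly_pareto_efficient U1 U2 C x)"

definition super_strong_nash ::
  "real^'n::finite^'m::finite \<Rightarrow> real^'m^'n \<Rightarrow> ('m, 'n) profile \<Rightarrow> bool" where
  "super_strong_nash U1 U2 x \<longleftrightarrow> nash_equilibrium U1 U2 x \<and>
    (\<forall>C. C \<noteq> {} \<longrightarrow> strictly_pareto_efficient U1 U2 C x)"

definition bimatrix_entry ::
  "real^'n::finite^'m::finite \<Rightarrow> real^'m^'n \<Rightarrow> 'm \<Rightarrow> 'n \<Rightarrow> real \<times> real" where
  "bimatrix_entry U1 U2 i j = (U1 $ i $ j, U2 $ j $ i)"

definition zero_sum :: "real^'n::finite^'m::finite \<Rightarrow> real^'m^'n \<Rightarrow> bool" where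
  "zero_sum U1 U2 \<longleftrightarrow>
    (\<forall>i j. fst (bimatrix_entry U1 U2 i j) + snd (bimatrix_entry U1 U2 i j) = 0)"

text \<open>
  Mixed strategies sum to one, so an affine transformation of a player's utility
  function acts on her matrix entrywise.
\<close>

definition affine_rescale ::
  "real \<Rightarrow> real \<Rightarrow> real^'l::finite^'k::finite \<Rightarrow> real^'l^'k" where
  "affine_rescale a b U = (\<chi> k l. a * U $ k $ l + b)"

definition strictly_competitive ::
  "real^'n::finite^'m::finite \<Rightarrow> real^'m^'n \<Rightarrow> bool" where
  "strictly_competitive U1 U2 \<longleftrightarrow>
    (\<exists>a b. a > 0 \<and> (zero_sum (affine_rescale a b U1) U2 \<or> zero_sum U1 (affine_rescale a b U2)))"

definition vertical_axis :: "(real \<times> real) set" where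
  "vertical_axis = {p. fst p = 0}"

definition horizontal_axis :: "(real \<times> real) set" where
  "horizontal_axis = {p. snd p = 0}"

end

theory Submission imports Defs begin

text \<open>
  Let \<open>(p, q)\<close> be the equilibrium, and let \<open>a\<close>, \<open>b\<close> be the payoffs in excess of the equilibrium
  payoffs, extended to bilinear forms on the whole space. Since \<open>(p, q)\<close> is fully mixed,
  \<open>a(\<cdot>, q) = 0\<close> and \<open>b(p, \<cdot>) = 0\<close>, and by homogeneity every \<open>(p + e s, q + e t)\<close> with small
  \<open>e > 0\<close> is a feasible deviation of the grand coalition, for arbitrary \<open>s\<close> and \<open>t\<close>. To first order
  in \<open>e\<close>, efficiency gives \<open>a(p, \<cdot>) = 0\<close> or \<open>b(\<cdot>, q) = 0\<close>. To second order it gives that one of the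
  forms vanishes or that \<open>a(s, t) b(s, t) \<le> 0\<close> everywhere, and two bilinear forms whose product is
  nowhere positive are proportional.
\<close>

section \<open>Pairs of bilinear forms\<close>

text \<open>On the kernel of \<open>f - g\<close> the product of the two functionals is a square, so
  nonpositivity forces both to vanish there.\<close>

lemma linear_functionals_proportional:
  fixes f g :: "'a::real_vector \<Rightarrow> real"
  assumes f: "linear f" and g: "linear g" and neg: "\<And>v. f v * g v \<le> 0"
  shows "f v * g w = f w * g v"
proof -
  \<comment> \<open>This combination lies in the kernel of \<open>f - g\<close>; the common value
    there is the determinant \<open>f v * g w - f w * g v\<close>.\<close>
  define u where "u = (g w - f w) *\<^sub>R v + (f v - g v) *\<^sub>R w"
  have "f u = f v * g w - f w * g v" "g u = f v * g w - f w * g v"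
    by (simp_all add: u_def linear_add[OF f] linear_add[OF g] linear_scale[OF f] linear_scale[OF g])
      (simp_all add: algebra_simps)
  with neg[of u] have "(f v * g w - f w * g v)\<^sup>2 \<le> 0"
    by (simp add: power2_eq_square)
  then show ?thesis by simp
qed

text \<open>Rows and columns are proportional by the result on functionals; the point is that the
  constant read off at \<open>(y, z)\<close> serves everywhere. The defect \<open>c\<close> inherits
  the row and column relations and vanishes on row \<open>y\<close> and column
  \<open>z\<close>.\<close>

lemma bilinear_nonpos_product_proportional:
  fixes a b :: "'a::real_vector \<Rightarrow> 'b::real_vector \<Rightarrow> real"
  assumes a: "bilinear a" and b: "bilinear b"
    and neg: "\<And>s t. a s t * b s t \<le> 0" and a0: "a y z \<noteq> 0"
  shows "b s t = b y z / a y z * a s t"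
proof -
  define k where "k = b y z / a y z"
  define c where "c s t = b s t - k * a s t" for s t
  have al: "linear (a s)" and bl: "linear (b s)" for s
    using a b by (auto simp: bilinear_def)
  have ar: "linear (\<lambda>s. a s t)" and br: "linear (\<lambda>s. b s t)" for t
    using a b by (auto simp: bilinear_def)
  have row: "a s t * c s t' = a s t' * c s t" for s t t'
    using linear_functionals_proportional[OF al bl neg, of s t t']
    by (simp add: c_def algebra_simps)
  have col: "a s t * c s' t = a s' t * c s t" for s s' t
    using linear_functionals_proportional[OF ar br neg, of s t s']
    by (simp add: c_def algebra_simps)
  have c0: "c y z = 0" using a0 by (simp add: c_def k_def)
  have cy: "c y t = 0" for t using row[of y z t] c0 a0 by simp
  have cz: "c s z = 0" for s using col[of y z s] c0 a0 by simp
  have cadd: "c (y + s) t = c s t" for s t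
    using cy[of t]
    by (simp add: c_def bilinear_ladd[OF a] bilinear_ladd[OF b] algebra_simps)
  \<comment> \<open>Rows \<open>y + s\<close> and \<open>s\<close> of \<open>c\<close> agree, and
    both vanish at \<open>z\<close>; if \<open>a\<close> does not vanish at
    \<open>(y + s, z)\<close>, the row relation kills the whole row.\<close>
  have *: "c s t = 0" if "a (y + s) z \<noteq> 0" for s t
    using row[of "y + s" z t] that by (simp add: cz cadd)
  have "c s t = 0"
  proof (cases "a (y + s) z = 0")
    case True
    \<comment> \<open>\<open>a (y + s) z\<close> and \<open>a (y + - s) z\<close> add up to
      \<open>2 * a y z\<close>, so they cannot both vanish.\<close>
    then have "a (y + - s) z \<noteq> 0"
      using a0 unfolding bilinear_ladd[OF a] bilinear_lneg[OF a] by linarith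
    then have "c (- s) t = 0" by (rule *)
    then show ?thesis
      by (simp add: c_def bilinear_lneg[OF a] bilinear_lneg[OF b])
  qed (rule *)
  then show ?thesis by (simp add: c_def k_def)
qed

section \<open>Signs of bilinear forms near a base point\<close>

lemma eventually_affine_pos:
  fixes x y :: real
  assumes "0 < x"
  shows "\<forall>\<^sub>F e in at_right 0. 0 < x + e * y"
proof (rule order_tendstoD(1))
  have "((\<lambda>e. x + e * y) \<longlongrightarrow> x + 0 * y) (at_right 0)"
    by (intro tendsto_intros)
  then show "((\<lambda>e. x + e * y) \<longlongrightarrow> x) (at_right 0)" by simp
qed (rule assms)

text \<open>With \<open>e\<close> factored out, the sign for small \<open>e > 0\<close> is that of
  \<open>b s q\<close>, or that of \<open>b s t\<close> when \<open>b s q\<close> vanishes.\<close>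

lemma bilinear_shift_left_null:
  fixes b :: "'a::real_vector \<Rightarrow> 'b::real_vector \<Rightarrow> real"
  assumes b: "bilinear b" and bp: "\<And>t. b p t = 0"
  shows "b (p + e *\<^sub>R s) (q + e *\<^sub>R t) = e * (b s q + e * b s t)"
  by (simp add: bilinear_ladd[OF b] bilinear_lmul[OF b] bilinear_radd[OF b] bilinear_rmul[OF b] bp
      distrib_left)

lemma bilinear_shift_right_null:
  fixes a :: "'a::real_vector \<Rightarrow> 'b::real_vector \<Rightarrow> real"
  assumes a: "bilinear a" and aq: "\<And>s. a s q = 0"
  shows "a (p + e *\<^sub>R s) (q + e *\<^sub>R t) = e * (a p t + e * a s t)"
  by (simp add: bilinear_ladd[OF a] bilinear_lmul[OF a] bilinear_radd[OF a] bilinear_rmul[OF a] aq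
      distrib_left)

lemma bilinear_swap: "bilinear a \<Longrightarrow> bilinear (\<lambda>t s. a s t)"
  by (auto simp: bilinear_def)

lemma bilinear_locally_nonpos_zero:
  fixes b :: "'a::real_vector \<Rightarrow> 'b::real_vector \<Rightarrow> real"
  assumes b: "bilinear b" and bp: "\<And>t. b p t = 0"
    and loc: "\<And>s t. \<forall>\<^sub>F e in at_right 0. \<not> 0 < b (p + e *\<^sub>R s) (q + e *\<^sub>R t)"
  shows "b s t = 0"
proof -
  have pos: "\<forall>\<^sub>F e in at_right (0::real). 0 < e"
    by (rule eventually_at_right_less)
  have nonpos_q: "\<not> 0 < b s q" for s
  proof
    assume *: "0 < b s q"
    \<comment> \<open>Taking \<open>t = 0\<close> removes the second-order term.\<close>
    from loc[of s 0] pos have "\<forall>\<^sub>F e in at_right (0::real). False"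
      by eventually_elim
        (use bilinear_shift_left_null[OF b bp, of _ s q 0] bilinear_rzero[OF b] * in auto)
    then show False by simp
  qed
  have bq: "b s q = 0" for s
    using nonpos_q[of s] nonpos_q[of "- s"] by (simp add: bilinear_lneg[OF b])
  have nonpos: "\<not> 0 < b s t" for s
  proof
    assume "0 < b s t"
    from loc[of s t] pos have "\<forall>\<^sub>F e in at_right (0::real). False"
      by eventually_elim (use bilinear_shift_left_null[OF b bp] bq \<open>0 < b s t\<close> in auto)
    then show False by simp
  qed
  from nonpos[of s] nonpos[of "- s"] show ?thesis by (simp add: bilinear_lneg[OF b])
qed

text \<open>As \<open>a p\<close> vanishes too, the shifted \<open>a\<close> is purely of second
  order, \<open>e * e * a s t\<close>. Either \<open>b\<close> has a first-order term, which forces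
  \<open>a = 0\<close>, or both forms are of second order and their product is nowhere
  positive.\<close>

lemma bilinear_no_common_improvement_aux:
  fixes a b :: "'a::real_vector \<Rightarrow> 'b::real_vector \<Rightarrow> real"
  assumes a: "bilinear a" and b: "bilinear b"
    and aq: "\<And>s. a s q = 0" and bp: "\<And>t. b p t = 0" and ap: "\<And>t. a p t = 0"
    and loc: "\<And>s t. \<forall>\<^sub>F e in at_right 0. \<not> (0 < a (p + e *\<^sub>R s) (q + e *\<^sub>R t) \<and>
                0 < b (p + e *\<^sub>R s) (q + e *\<^sub>R t))"
  shows "(\<forall>s t. a s t = 0) \<or> (\<forall>s t. b s t = 0) \<or> (\<exists>k>0. \<forall>s t. b s t = - k * a s t)"
proof -
  have pos: "\<forall>\<^sub>F e in at_right (0::real). 0 < e"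
    by (rule eventually_at_right_less)
  note shift = bilinear_shift_left_null[OF b bp] bilinear_shift_right_null[OF a aq]
  have 1: "\<not> (0 < a s t \<and> 0 < b s q)" for s t
  proof
    assume *: "0 < a s t \<and> 0 < b s q"
    then have "\<forall>\<^sub>F e in at_right 0. 0 < b s q + e * b s t"
      by (intro eventually_affine_pos) simp
    with loc[of s t] pos have "\<forall>\<^sub>F e in at_right (0::real). False"
      by eventually_elim (use shift ap * in auto)
    then show False by simp
  qed
  show ?thesis
  proof (cases "\<forall>s. b s q = 0")
    case False
    then obtain s0 where s0: "b s0 q \<noteq> 0" by blast
    \<comment> \<open>Changing the signs of \<open>s\<close> and \<open>t\<close> independently
      yields every sign pattern of \<open>a s t\<close> and \<open>b s q\<close>.\<close>
    have az: "a s t = 0" if "b s q \<noteq> 0" for s t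
      using 1[of s t] 1[of s "- t"] 1[of "- s" t] 1[of "- s" "- t"] that
      by (auto simp: bilinear_lneg[OF a] bilinear_lneg[OF b] bilinear_rneg[OF a] neq_iff)
    have "a s t = 0" for s t
    proof (cases "b s q = 0")
      case True
      \<comment> \<open>Both \<open>s + s0\<close> and \<open>s0\<close> lie off the kernel of
        \<open>b _ q\<close>, and \<open>s\<close> is their difference.\<close>
      then have "a (s + s0) t = 0" using s0 by (intro az) (simp add: bilinear_ladd[OF b])
      then show ?thesis using az[OF s0, of t] by (simp add: bilinear_ladd[OF a])
    qed (rule az)
    then show ?thesis by blast
  next
    case bq: True
    have 2: "\<not> (0 < a s t \<and> 0 < b s t)" for s t
    proof
      assume *: "0 < a s t \<and> 0 < b s t"
      from loc[of s t] pos have "\<forall>\<^sub>F e in at_right (0::real). False"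
        by eventually_elim (use shift ap bq * in auto)
      then show False by simp
    qed
    \<comment> \<open>Replacing \<open>s\<close> by \<open>- s\<close> flips both signs, so both
      values being negative is excluded as well.\<close>
    have neg: "a s t * b s t \<le> 0" for s t
      using 2[of s t] 2[of "- s" t]
      by (auto simp: bilinear_lneg[OF a] bilinear_lneg[OF b] mult_le_0_iff)
    show ?thesis
    proof (cases "\<forall>s t. a s t = 0")
      case False
      then obtain y z where yz: "a y z \<noteq> 0" by blast
      define k where "k = - (b y z / a y z)"
      have k: "b s t = - k * a s t" for s t
        unfolding k_def using bilinear_nonpos_product_proportional[OF a b neg yz, of s t] by simp
      have "0 \<le> k"
        using neg[of y z] yz by (auto simp: k_def divide_le_0_iff mult_le_0_iff)
      then consider "k = 0" | "0 < k" by linarith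
      then show ?thesis using k by cases auto
    qed blast
  qed
qed

text \<open>If \<open>a p t > 0\<close> for some \<open>t\<close>, no \<open>s\<close> may have
  \<open>b s q > 0\<close>, since both first-order terms would then be positive; hence
  \<open>b _ q\<close> vanishes and the auxiliary case applies with the roles of the forms and of
  their arguments exchanged.\<close>

lemma bilinear_no_common_improvement:
  fixes a b :: "'a::real_vector \<Rightarrow> 'b::real_vector \<Rightarrow> real"
  assumes a: "bilinear a" and b: "bilinear b"
    and aq: "\<And>s. a s q = 0" and bp: "\<And>t. b p t = 0"
    and loc: "\<And>s t. \<forall>\<^sub>F e in at_right 0. \<not> (0 < a (p + e *\<^sub>R s) (q + e *\<^sub>R t) \<and>
                0 < b (p + e *\<^sub>R s) (q + e *\<^sub>R t))"
  shows "(\<forall>s t. a s t = 0) \<or> (\<forall>s t. b s t = 0) \<or> (\<exists>k>0. \<forall>s t. b s t = - k * a s t)"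
proof (cases "\<forall>t. a p t = 0")
  case True
  then show ?thesis by (intro bilinear_no_common_improvement_aux[OF a b aq bp _ loc]) auto
next
  case False
  then obtain t0 where "a p t0 \<noteq> 0" by blast
  then obtain t where t: "0 < a p t"
    by (metis bilinear_rneg[OF a] neg_0_less_iff_less linorder_neqE_linordered_idom)
  have pos: "\<forall>\<^sub>F e in at_right (0::real). 0 < e"
    by (rule eventually_at_right_less)
  have nonpos: "\<not> 0 < b s q" for s
  proof
    assume "0 < b s q"
    from eventually_affine_pos[OF this, of "b s t"] eventually_affine_pos[OF t, of "a s t"]
      loc[of s t] pos
    have "\<forall>\<^sub>F e in at_right (0::real). False"
      by eventually_elim
        (use bilinear_shift_left_null[OF b bp] bilinear_shift_right_null[OF a aq] in auto)
    then show False by simp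
  qed
  have bq: "b s q = 0" for s
    using nonpos[of s] nonpos[of "- s"] by (simp add: bilinear_lneg[OF b])
  have "(\<forall>t s. b s t = 0) \<or> (\<forall>t s. a s t = 0) \<or> (\<exists>k>0. \<forall>t s. a s t = - k * b s t)"
    by (rule bilinear_no_common_improvement_aux
          [OF bilinear_swap[OF b] bilinear_swap[OF a] bp aq bq])
      (use loc in \<open>simp add: conj_commute\<close>)
  moreover have "\<exists>k>0. \<forall>s t. b s t = - k * a s t"
    if "0 < k" "\<forall>t s. a s t = - k * b s t" for k
    by (intro exI[of _ "1 / k"]) (use that in auto)
  ultimately show ?thesis by blast
qed

section \<open>Fully mixed equilibria\<close>

text \<open>The correction term is homogenized, so that the excess is bilinear in the strategies.\<close>

definition excess :: "real^'l::finite^'k::finite \<Rightarrow> real \<Rightarrow> real^'k \<Rightarrow> real^'l \<Rightarrow> real" where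
  "excess U c s t = s \<bullet> (U *v t) - c * (\<Sum>k\<in>UNIV. s $ k) * (\<Sum>l\<in>UNIV. t $ l)"

lemma bilinear_excess: "bilinear (excess U c)"
  unfolding bilinear_def
  by (intro conjI allI linearI)
    (simp_all add: excess_def inner_simps matrix_vector_right_distrib matrix_vector_mult_scaleR
      sum.distrib sum_distrib_left[symmetric] algebra_simps)

lemma sum_axis: "(\<Sum>i\<in>UNIV. axis j (1::real) $ i) = 1"
  by (simp add: axis_def)

lemma excess_axis: "excess U c (axis k 1) (axis l 1) = U $ k $ l - c"
  by (simp add: excess_def sum_axis inner_axis' matrix_vector_mult_basis column_def)

lemma excess_scaleR: "excess U c (r *\<^sub>R s) (r' *\<^sub>R t) = r * r' * excess U c s t"
  by (simp add: bilinear_lmul[OF bilinear_excess] bilinear_rmul[OF bilinear_excess])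

section \<open>Positive vectors as profiles, and indifference at equilibrium\<close>

lemma normalize_simplex:
  fixes y :: "real^'k::finite"
  assumes "\<And>k. 0 < y $ k"
  obtains r where "0 < r" "r *\<^sub>R y \<in> simplex_strategies"
proof
  have pos: "0 < (\<Sum>k\<in>UNIV. y $ k)" by (intro sum_pos) (use assms in auto)
  then show "0 < 1 / (\<Sum>k\<in>UNIV. y $ k)" by simp
  show "(1 / (\<Sum>k\<in>UNIV. y $ k)) *\<^sub>R y \<in> simplex_strategies"
    using pos assms
    by (auto simp: simplex_strategies_def sum_divide_distrib[symmetric] less_imp_le)
qed

text \<open>Normalizing both vectors multiplies each excess by the same positive factor
  \<open>r\<close>, so payoff comparisons with \<open>c\<close> become signs of excesses and
  perturbations need not preserve the coordinate sums.\<close>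

lemma positive_profile:
  fixes y :: "real^'m::finite" and z :: "real^'n::finite"
  assumes "\<And>i. 0 < y $ i" "\<And>j. 0 < z $ j"
  obtains r w where "0 < r" "w \<in> profiles"
    "\<And>U1 U2 c. payoff U1 U2 Player1 w = c + r * excess U1 c y z"
    "\<And>U1 U2 c. payoff U1 U2 Player2 w = c + r * excess U2 c z y"
proof -
  obtain r1 where r1: "0 < r1" "r1 *\<^sub>R y \<in> simplex_strategies"
    using normalize_simplex[of y] assms by blast
  obtain r2 where r2: "0 < r2" "r2 *\<^sub>R z \<in> simplex_strategies"
    using normalize_simplex[of z] assms by blast
  have ex: "s \<bullet> (U *v t) = c + excess U c s t"
    if "s \<in> simplex_strategies" "t \<in> simplex_strategies"
    for U :: "real^'l::finite^'k::finite" and c s t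
    using that by (simp add: excess_def simplex_strategies_def)
  show thesis
  proof (rule that[of "r1 * r2" "(r1 *\<^sub>R y, r2 *\<^sub>R z)"])
    fix U1 :: "real^'n^'m" and U2 :: "real^'m^'n" and c
    show "payoff U1 U2 Player1 (r1 *\<^sub>R y, r2 *\<^sub>R z) = c + r1 * r2 * excess U1 c y z"
      using ex[OF r1(2) r2(2), of U1 c] by (simp only: payoff.simps fst_conv snd_conv excess_scaleR)
    show "payoff U1 U2 Player2 (r1 *\<^sub>R y, r2 *\<^sub>R z) = c + r1 * r2 * excess U2 c z y"
      using ex[OF r2(2) r1(2), of U2 c]
      by (simp only: payoff.simps fst_conv snd_conv excess_scaleR mult.commute[of r1])
  qed (use r1 r2 in \<open>auto simp: profiles_def\<close>)
qed

text \<open>Pure deviations make all gaps \<open>p \<bullet> w - w $ j\<close> nonnegative; their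
  average under the positive weights \<open>p\<close> is zero, so each gap is zero.\<close>

lemma indifference:
  fixes p w :: "real^'k::finite"
  assumes p: "p \<in> simplex_strategies" "\<And>k. 0 < p $ k"
    and best: "\<And>y. y \<in> simplex_strategies \<Longrightarrow> y \<bullet> w \<le> p \<bullet> w"
  shows "w $ k = p \<bullet> w"
proof -
  have le: "w $ j \<le> p \<bullet> w" for j
  proof -
    have "axis j 1 \<in> simplex_strategies"
      by (simp add: simplex_strategies_def sum_axis) (simp add: axis_def)
    from best[OF this] show ?thesis by (simp add: inner_axis')
  qed
  have "(\<Sum>j\<in>UNIV. p $ j * (p \<bullet> w - w $ j)) = (\<Sum>j\<in>UNIV. p $ j) * (p \<bullet> w) - p \<bullet> w"
    by (simp add: inner_vec_def right_diff_distrib sum_subtractf sum_distrib_right)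
  also have "\<dots> = 0" using p by (simp add: simplex_strategies_def)
  finally have "\<forall>j\<in>UNIV. p $ j * (p \<bullet> w - w $ j) = 0"
    by (subst (asm) sum_nonneg_eq_0_iff) (use p le in \<open>auto simp: less_imp_le\<close>)
  then have "p $ k * (p \<bullet> w - w $ k) = 0" by blast
  then show ?thesis using p(2)[of k] by simp
qed

text \<open>By indifference \<open>U *v q\<close> is constant, so its product with any vector
  \<open>s\<close>, strategy or not, is cancelled by the homogenized correction.\<close>

lemma excess_equilibrium_zero:
  assumes p: "p \<in> simplex_strategies" "\<And>k. 0 < p $ k" and q: "q \<in> simplex_strategies"
    and best: "\<And>y. y \<in> simplex_strategies \<Longrightarrow> y \<bullet> (U *v q) \<le> p \<bullet> (U *v q)"
  shows "excess U (p \<bullet> (U *v q)) s q = 0"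
proof -
  define c where "c = p \<bullet> (U *v q)"
  have "(U *v q) $ k = c" for k
    unfolding c_def by (rule indifference[OF p best])
  then have "s \<bullet> (U *v q) = c * (\<Sum>k\<in>UNIV. s $ k)"
    by (simp add: inner_vec_def sum_distrib_left mult.commute)
  then show ?thesis using q by (simp add: excess_def simplex_strategies_def c_def)
qed

lemma fully_mixed_nash_excess:
  assumes nash: "nash_equilibrium U1 U2 x" and fm: "fully_mixed x"
  shows "excess U1 (payoff U1 U2 Player1 x) s (snd x) = 0"
    and "excess U2 (payoff U1 U2 Player2 x) t (fst x) = 0"
proof -
  have x: "fst x \<in> simplex_strategies" "snd x \<in> simplex_strategies"
    using nash by (auto simp: nash_equilibrium_def profiles_def)
  have dev: "payoff U1 U2 pl y \<le> payoff U1 U2 pl x" if "y \<in> coalition_deviations {pl} x" for pl y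
    using nash that by (auto simp: nash_equilibrium_def not_less)
  have "y \<bullet> (U1 *v snd x) \<le> fst x \<bullet> (U1 *v snd x)" if "y \<in> simplex_strategies" for y
    using dev[of "(y, snd x)" Player1] that x by (simp add: coalition_deviations_def profiles_def)
  from excess_equilibrium_zero[OF x(1) _ x(2) this] fm
  show "excess U1 (payoff U1 U2 Player1 x) s (snd x) = 0" by (simp add: fully_mixed_def)
  have "y \<bullet> (U2 *v fst x) \<le> snd x \<bullet> (U2 *v fst x)" if "y \<in> simplex_strategies" for y
    using dev[of "(fst x, y)" Player2] that x by (simp add: coalition_deviations_def profiles_def)
  from excess_equilibrium_zero[OF x(2) _ x(1) this] fm
  show "excess U2 (payoff U1 U2 Player2 x) t (fst x) = 0" by (simp add: fully_mixed_def)
qed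

section \<open>Efficiency for the grand coalition in terms of excesses\<close>

lemma eventually_perturbation_pos:
  fixes p :: "real^'k::finite"
  assumes "\<And>k. 0 < p $ k"
  shows "\<forall>\<^sub>F e in at_right 0. \<forall>k. 0 < (p + e *\<^sub>R s) $ k"
  by (intro eventually_all_finite) (simp add: eventually_affine_pos assms)

lemma player_all: "(\<forall>pl. P pl) \<longleftrightarrow> P Player1 \<and> P Player2"
  by (metis player.exhaust)

lemma player_ex: "(\<exists>pl. P pl) \<longleftrightarrow> P Player1 \<or> P Player2"
  by (metis player.exhaust)

lemma weakly_pareto_excess:
  assumes eff: "weakly_pareto_efficient U1 U2 UNIV x"
    and y: "\<And>i. 0 < y $ i" and z: "\<And>j. 0 < z $ j"
  shows "\<not> (0 < excess U1 (payoff U1 U2 Player1 x) y z \<and>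
            0 < excess U2 (payoff U1 U2 Player2 x) z y)"
proof -
  obtain r w where rw: "0 < r" "w \<in> profiles"
    "\<And>c. payoff U1 U2 Player1 w = c + r * excess U1 c y z"
    "\<And>c. payoff U1 U2 Player2 w = c + r * excess U2 c z y"
    using positive_profile[of y z] y z by metis
  have "\<not> (\<forall>pl. payoff U1 U2 pl x < payoff U1 U2 pl w)"
    using eff rw(2) by (auto simp: weakly_pareto_efficient_def coalition_deviations_def)
  then show ?thesis
    using rw(1) rw(3)[of "payoff U1 U2 Player1 x"] rw(4)[of "payoff U1 U2 Player2 x"]
    by (auto simp del: payoff.simps simp: player_all)
qed

lemma strictly_pareto_excess:
  assumes eff: "strictly_pareto_efficient U1 U2 UNIV x"
    and y: "\<And>i. 0 < y $ i" and z: "\<And>j. 0 < z $ j"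
  defines "\<alpha> \<equiv> excess U1 (payoff U1 U2 Player1 x) y z"
    and "\<beta> \<equiv> excess U2 (payoff U1 U2 Player2 x) z y"
  shows "\<not> (0 \<le> \<alpha> \<and> 0 \<le> \<beta> \<and> (0 < \<alpha> \<or> 0 < \<beta>))"
proof -
  obtain r w where rw: "0 < r" "w \<in> profiles"
    "\<And>c. payoff U1 U2 Player1 w = c + r * excess U1 c y z"
    "\<And>c. payoff U1 U2 Player2 w = c + r * excess U2 c z y"
    using positive_profile[of y z] y z by metis
  have "\<not> ((\<forall>pl. payoff U1 U2 pl x \<le> payoff U1 U2 pl w) \<and>
           (\<exists>pl. payoff U1 U2 pl x < payoff U1 U2 pl w))"
    using eff rw(2) by (auto simp: strictly_pareto_efficient_def coalition_deviations_def)
  then show ?thesis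
    using rw(1) rw(3)[of "payoff U1 U2 Player1 x"] rw(4)[of "payoff U1 U2 Player2 x"]
    unfolding \<alpha>_def \<beta>_def by (auto simp del: payoff.simps simp: player_all player_ex)
qed

lemma super_strong_imp_strong: "super_strong_nash U1 U2 x \<Longrightarrow> strong_nash U1 U2 x"
  unfolding super_strong_nash_def strong_nash_def weakly_pareto_efficient_def
    strictly_pareto_efficient_def
  by (meson all_not_in_conv less_imp_le)

text \<open>The arguments of \<open>b\<close> are swapped so that player 1's vector comes first in
  both forms. Small perturbations of a fully mixed profile stay positive, so efficiency rules out a
  common improvement in every direction.\<close>

lemma strong_nash_fully_mixed_excess:
  fixes U1 :: "real^'n::finite^'m::finite" and U2 :: "real^'m^'n"
  assumes strong: "strong_nash U1 U2 x" and fm: "fully_mixed x"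
  defines "a \<equiv> excess U1 (payoff U1 U2 Player1 x)"
    and "b \<equiv> \<lambda>s t. excess U2 (payoff U1 U2 Player2 x) t s"
  shows "(\<forall>s t. a s t = 0) \<or> (\<forall>s t. b s t = 0) \<or> (\<exists>k>0. \<forall>s t. b s t = - k * a s t)"
proof (rule bilinear_no_common_improvement)
  have nash: "nash_equilibrium U1 U2 x" and eff: "weakly_pareto_efficient U1 U2 UNIV x"
    using strong by (auto simp: strong_nash_def)
  show "bilinear a" "bilinear b"
    unfolding a_def b_def by (rule bilinear_excess, rule bilinear_swap[OF bilinear_excess])
  show "a s (snd x) = 0" "b (fst x) t = 0" for s t
    unfolding a_def b_def by (fact fully_mixed_nash_excess[OF nash fm])+
  have pos: "\<And>i. 0 < fst x $ i" "\<And>j. 0 < snd x $ j"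
    using fm by (auto simp: fully_mixed_def)
  show "\<forall>\<^sub>F e in at_right 0. \<not> (0 < a (fst x + e *\<^sub>R s) (snd x + e *\<^sub>R t) \<and>
          0 < b (fst x + e *\<^sub>R s) (snd x + e *\<^sub>R t))" for s t
    using eventually_perturbation_pos[of "fst x" s, OF pos(1)]
      eventually_perturbation_pos[of "snd x" t, OF pos(2)]
    unfolding a_def b_def
    by eventually_elim (intro weakly_pareto_excess eff; blast)
qed

text \<open>When one form is identically zero, that player never objects, so strict efficiency keeps
  the other form from being positive near \<open>x\<close>; such a form vanishes.\<close>

lemma super_strong_nash_excess_zero:
  fixes U1 :: "real^'n::finite^'m::finite" and U2 :: "real^'m^'n"
  assumes super: "super_strong_nash U1 U2 x" and fm: "fully_mixed x"
  defines "a \<equiv> excess U1 (payoff U1 U2 Player1 x)"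
    and "b \<equiv> \<lambda>s t. excess U2 (payoff U1 U2 Player2 x) t s"
  shows "(\<forall>s t. a s t = 0) \<longleftrightarrow> (\<forall>s t. b s t = 0)"
proof -
  have nash: "nash_equilibrium U1 U2 x" and eff: "strictly_pareto_efficient U1 U2 UNIV x"
    using super by (auto simp: super_strong_nash_def)
  have bil: "bilinear a" "bilinear b"
    unfolding a_def b_def by (rule bilinear_excess, rule bilinear_swap[OF bilinear_excess])
  have null: "a s (snd x) = 0" "b (fst x) t = 0" for s t
    unfolding a_def b_def by (fact fully_mixed_nash_excess[OF nash fm])+
  have pos: "\<And>i. 0 < fst x $ i" "\<And>j. 0 < snd x $ j"
    using fm by (auto simp: fully_mixed_def)
  have loc: "\<forall>\<^sub>F e in at_right 0.
      \<not> (0 \<le> a (fst x + e *\<^sub>R s) (snd x + e *\<^sub>R t) \<and> 0 \<le> b (fst x + e *\<^sub>R s) (snd x + e *\<^sub>R t) \<and>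
        (0 < a (fst x + e *\<^sub>R s) (snd x + e *\<^sub>R t) \<or> 0 < b (fst x + e *\<^sub>R s) (snd x + e *\<^sub>R t)))"
    for s t
    using eventually_perturbation_pos[of "fst x" s, OF pos(1)]
      eventually_perturbation_pos[of "snd x" t, OF pos(2)]
    unfolding a_def b_def
    by eventually_elim (intro strictly_pareto_excess eff; blast)
  show ?thesis
  proof
    assume "\<forall>s t. a s t = 0"
    then have "\<forall>\<^sub>F e in at_right 0. \<not> 0 < b (fst x + e *\<^sub>R s) (snd x + e *\<^sub>R t)" for s t
      using loc[of s t] by (auto elim!: eventually_mono)
    then show "\<forall>s t. b s t = 0"
      using bilinear_locally_nonpos_zero[OF bil(2) null(2)] by blast
  next
    assume "\<forall>s t. b s t = 0"
    then have "\<forall>\<^sub>F e in at_right 0. \<not> 0 < a (fst x + e *\<^sub>R s) (snd x + e *\<^sub>R t)" for s t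
      using loc[of s t] by (auto elim!: eventually_mono)
    then show "\<forall>s t. a s t = 0"
      using bilinear_locally_nonpos_zero[OF bilinear_swap[OF bil(1)] null(1)] by blast
  qed
qed

section \<open>From excesses back to the game\<close>

lemma strictly_competitive_if_excess:
  assumes "0 < k" "\<And>s t. excess U2 c2 t s = - k * excess U1 c1 s t"
  shows "strictly_competitive U1 U2"
proof -
  \<comment> \<open>At pure strategies the excess is an entry minus the constant; the shift in the
    rescaling below cancels \<open>k * c1 + c2\<close>.\<close>
  have "k * U1 $ i $ j + U2 $ j $ i = k * c1 + c2" for i j
    using assms(2)[of "axis j 1" "axis i 1"] by (simp add: excess_axis algebra_simps)
  then have "zero_sum (affine_rescale k (- (k * c1 + c2)) U1) U2"
    by (simp add: zero_sum_def affine_rescale_def bimatrix_entry_def algebra_simps)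
  with assms(1) show ?thesis unfolding strictly_competitive_def by blast
qed

theorem corollary3p1:
  fixes U1 :: "real^'n::finite^'m::finite" and U2 :: "real^'m^'n"
  assumes "max CARD('m) CARD('n) \<ge> 2"
  shows
    "((\<exists>x. super_strong_nash U1 U2 x \<and> fully_mixed x) \<longrightarrow> strictly_competitive U1 U2) \<and>
     ((\<exists>x. strong_nash U1 U2 x \<and> fully_mixed x \<and> (\<forall>p. payoff U1 U2 p x = 0)) \<longrightarrow>
        strictly_competitive U1 U2 \<or>
        (\<forall>i j. bimatrix_entry U1 U2 i j \<in> vertical_axis) \<or>
        (\<forall>i j. bimatrix_entry U1 U2 i j \<in> horizontal_axis))"
proof (intro conjI impI; elim exE conjE)
  fix x assume x: "super_strong_nash U1 U2 x" "fully_mixed x"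
  let ?a = "excess U1 (payoff U1 U2 Player1 x)"
  let ?b = "\<lambda>s t. excess U2 (payoff U1 U2 Player2 x) t s"
  \<comment> \<open>If one form vanishes, both do, and \<open>k = 1\<close> serves.\<close>
  have "\<exists>k>0. \<forall>s t. ?b s t = - k * ?a s t"
    using strong_nash_fully_mixed_excess[OF super_strong_imp_strong[OF x(1)] x(2)]
      super_strong_nash_excess_zero[OF x]
    by (metis mult_zero_right zero_less_one)
  then show "strictly_competitive U1 U2"
    using strictly_competitive_if_excess by blast
next
  fix x assume x: "strong_nash U1 U2 x" "fully_mixed x" and zero: "\<forall>p. payoff U1 U2 p x = 0"
  \<comment> \<open>With equilibrium payoffs zero, the excess at pure strategies is the matrix entry
    itself, so a vanishing form means a zero matrix.\<close>
  consider "\<forall>s t. excess U1 0 s t = 0" | "\<forall>s t. excess U2 0 t s = 0"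
    | k where "0 < k" "\<forall>s t. excess U2 0 t s = - k * excess U1 0 s t"
    using strong_nash_fully_mixed_excess[OF x] unfolding zero[rule_format] by blast
  then show "strictly_competitive U1 U2 \<or>
        (\<forall>i j. bimatrix_entry U1 U2 i j \<in> vertical_axis) \<or>
        (\<forall>i j. bimatrix_entry U1 U2 i j \<in> horizontal_axis)"
  proof cases
    case 1
    then have "U1 $ i $ j = 0" for i j
      using excess_axis[of U1 0 i j] by simp
    then show ?thesis by (simp add: bimatrix_entry_def vertical_axis_def)
  next
    case 2
    then have "U2 $ j $ i = 0" for i j
      using excess_axis[of U2 0 j i] by simp
    then show ?thesis by (simp add: bimatrix_entry_def horizontal_axis_def)
  next
    case 3
    then show ?thesis using strictly_competitive_if_excess by blast
  qed
qed

end
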